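(* For each integer $k \geq 0$, the graph $H_k$ contains two adjacent vertices such that there is no path between them whose length is in $\{3,5,7,\ldots,9+4k\}$ (the set of all odd integers from $3$ to $9+4k$).
   Context: All graphs are finite and simple; $uv$ denotes the edge between $u$ and $v$. The length of a path is its number of edges. Definition of $H_k$. Each $H_k$ comes with seven distinguished vertices labelled $a,b,c,d,e,f,g$ which induce the graph with edge set $\{ab, ac, bc, af, fg, gd, dc, be, de\}$. $H_0$ is the cubic planar graph on the $16$ vertices $x_0,x_1,\ldots,x_8,a,b,c,d,e,f,g$ with the following $24$ edges: $x_0x_1$, $x_0x_2$, $x_0x_6$, $x_1x_3$, $x_1x_4$, $x_2x_3$, $x_4x_5$, $x_4x_7$, $x_5x_6$, $x_5x_7$, $x_6x_8$, $x_7x_8$, $x_2f$, $x_3e$, $x_8g$, $ab$, $ac$, $bc$, $af$, $fg$, $gd$, $dc$, $be$, $de$. For $k\ge 1$, $H_k$ (on $16+6k$ vertices) is obtained from $H_{k-1}$, with distinguished vertices $a,b,c,d,e,f,g$, by deleting the edges $ac$ and $bc$, adding six new vertices $a',a'',b',b'',c',c''$, and adding the edges $aa'$, $a'c$, $a'a''$, $a''b''$, $a''c''$, $b''c''$, $b''b'$, $c''c'$, $b'c'$, $b'b$, $c'c$. The new distinguished vertices of $H_k$, in the roles of $a,b,c,d,e,f,g$ respectively, are $a'',b'',c'',c',b',a',c$. *)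

theory Defs
  imports "Graph_Theory.Graph_Theory"
begin

text \<open>
  A finite simple graph is a \<^locale>\<open>pair_graph\<close>: a finite loop-free digraph without
  parallel arcs whose arc relation is symmetric, the edge \<open>uv\<close> being the pair of arcs
  \<open>(u, v)\<close> and \<open>(v, u)\<close>. A path is an \<open>apath\<close>, a walk (a list of consecutive arcs) without
  repeated vertices, and its length is the length of this list.
\<close>

definition edges_of :: "('v \<times> 'v) set \<Rightarrow> ('v \<times> 'v) set" where
  "edges_of S = S \<union> S\<inverse>"

text \<open>
  \<open>Va, \<dots>, Vg\<close> are the vertices \<open>a, \<dots>, g\<close> of \<open>H\<^sub>0\<close>. The vertices \<open>a', a'', b', b'', c', c''\<close> added
  in passing from \<open>H\<^bsub>k-1\<^esub>\<close> to \<open>H\<^sub>k\<close> are \<open>A1 k, A2 k, B1 k, B2 k, C1 k, C2 k\<close>; the index makes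
  them new at every step.
\<close>

datatype vertex =
    X nat
  | Va | Vb | Vc | Vd | Ve | Vf | Vg
  | A1 nat | A2 nat | B1 nat | B2 nat | C1 nat | C2 nat

text \<open>A graph with seven distinguished vertices, in the order \<open>a, b, c, d, e, f, g\<close>.\<close>

type_synonym 'v marked_graph = "'v pair_pre_digraph \<times> 'v \<times> 'v \<times> 'v \<times> 'v \<times> 'v \<times> 'v \<times> 'v"

definition H_base :: "vertex pair_pre_digraph" where
  "H_base =
    \<lparr> pverts = X ` {0..8} \<union> {Va, Vb, Vc, Vd, Ve, Vf, Vg},
      parcs = edges_of
        {(X 0, X 1), (X 0, X 2), (X 0, X 6), (X 1, X 3), (X 1, X 4), (X 2, X 3),
         (X 4, X 5), (X 4, X 7), (X 5, X 6), (X 5, X 7), (X 6, X 8), (X 7, X 8),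
         (X 2, Vf), (X 3, Ve), (X 8, Vg),
         (Va, Vb), (Va, Vc), (Vb, Vc), (Va, Vf), (Vf, Vg), (Vg, Vd), (Vd, Vc),
         (Vb, Ve), (Vd, Ve)} \<rparr>"

primrec marked_H :: "nat \<Rightarrow> vertex marked_graph" where
  "marked_H 0 = (H_base, Va, Vb, Vc, Vd, Ve, Vf, Vg)"
| "marked_H (Suc k) =
    (case marked_H k of (G, a, b, c, d, e, f, g) \<Rightarrow>
      let a' = A1 (Suc k); a'' = A2 (Suc k);
          b' = B1 (Suc k); b'' = B2 (Suc k);
          c' = C1 (Suc k); c'' = C2 (Suc k)
      in (\<lparr> pverts = pverts G \<union> {a', a'', b', b'', c', c''},
            parcs = (parcs G - edges_of {(a, c), (b, c)}) \<union>
              edges_of {(a, a'), (a', c), (a', a''), (a'', b''), (a'', c''), (b'', c''),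
                        (b'', b'), (c'', c'), (b', c'), (b', b), (c', c)} \<rparr>,
          a'', b'', c'', c', b', a', c))"

definition H :: "nat \<Rightarrow> vertex pair_pre_digraph" where
  "H k = fst (marked_H k)"

text \<open>
  The following facts confirm that \<open>H\<^sub>k\<close> is a simple graph on \<open>16 + 6k\<close> vertices whose
  distinguished vertices induce the intended subgraph, so that every edge deleted by the
  recursion is present and every added vertex is new.
\<close>

definition fresh_above :: "nat \<Rightarrow> vertex set \<Rightarrow> bool" where
  "fresh_above k V \<longleftrightarrow>
    (\<forall>j>k. V \<inter> {A1 j, A2 j, B1 j, B2 j, C1 j, C2 j} = {})"

definition marked_ok :: "nat \<Rightarrow> vertex marked_graph \<Rightarrow> bool" where
  "marked_ok k M \<longleftrightarrow> (case M of (G, a, b, c, d, e, f, g) \<Rightarrow>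
     finite (pverts G) \<and> card (pverts G) = 16 + 6 * k \<and> fresh_above k (pverts G) \<and>
     parcs G \<subseteq> pverts G \<times> pverts G \<and> sym (parcs G) \<and> irrefl (parcs G) \<and>
     distinct [a, b, c, d, e, f, g] \<and> {a, b, c, d, e, f, g} \<subseteq> pverts G \<and>
     parcs G \<inter> {a, b, c, d, e, f, g} \<times> {a, b, c, d, e, f, g} =
       edges_of {(a, b), (a, c), (b, c), (a, f), (f, g), (g, d), (d, c), (b, e), (d, e)})"

lemma edges_of_empty: "edges_of {} = {}"
  by (simp add: edges_of_def)

lemma edges_of_insert: "edges_of (insert (x, y) S) = insert (x, y) (insert (y, x) (edges_of S))"
  by (auto simp: edges_of_def)

lemma sym_edges_of: "sym (edges_of S)"
  unfolding edges_of_def by (rule sym_Un_converse)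

lemmas edges_of_simps = edges_of_empty edges_of_insert

lemma marked_ok_0: "marked_ok 0 (marked_H 0)"
proof -
  have X: "X ` {0..8} = {X 0, X 1, X 2, X 3, X 4, X 5, X 6, X 7, X 8}"
  proof -
    have "{0..8} = {0, 1, 2, 3, 4, 5, 6, 7, 8 :: nat}"
      by auto
    then show ?thesis by simp
  qed
  have "card (pverts H_base) = 16" "finite (pverts H_base)" "fresh_above 0 (pverts H_base)"
    unfolding H_base_def fresh_above_def by (simp_all add: X)
  moreover have "parcs H_base \<subseteq> pverts H_base \<times> pverts H_base"
    unfolding H_base_def edges_of_simps by (simp add: X del: insert_Times_insert)
  moreover have "sym (parcs H_base)"
    unfolding H_base_def by (simp only: pair_pre_digraph.simps sym_edges_of)
  moreover have "irrefl (parcs H_base)"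
    unfolding H_base_def edges_of_simps irrefl_def by simp
  moreover have "{Va, Vb, Vc, Vd, Ve, Vf, Vg} \<subseteq> pverts H_base"
    unfolding H_base_def by simp
  moreover have "parcs H_base \<inter> {Va, Vb, Vc, Vd, Ve, Vf, Vg} \<times> {Va, Vb, Vc, Vd, Ve, Vf, Vg} =
      edges_of {(Va, Vb), (Va, Vc), (Vb, Vc), (Va, Vf), (Vf, Vg), (Vg, Vd), (Vd, Vc),
        (Vb, Ve), (Vd, Ve)}"
    unfolding H_base_def edges_of_simps by (simp add: Int_insert_left del: insert_Times_insert)
  ultimately show ?thesis
    unfolding marked_ok_def by simp
qed

lemma marked_ok_Suc:
  assumes "marked_ok k (marked_H k)"
  shows "marked_ok (Suc k) (marked_H (Suc k))"
proof -
  obtain G a b c d e f g where M: "marked_H k = (G, a, b, c, d, e, f, g)"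
    by (cases "marked_H k") auto
  let ?j = "Suc k"
  let ?N = "{A1 ?j, A2 ?j, B1 ?j, B2 ?j, C1 ?j, C2 ?j}"
  have fin: "finite (pverts G)" and card: "card (pverts G) = 16 + 6 * k"
    and fr: "fresh_above k (pverts G)" and sub: "parcs G \<subseteq> pverts G \<times> pverts G"
    and sy: "sym (parcs G)" and irr: "irrefl (parcs G)"
    and dist: "distinct [a, b, c, d, e, f, g]"
    and V: "a \<in> pverts G" "b \<in> pverts G" "c \<in> pverts G"
    using assms unfolding M marked_ok_def by auto
  have disj: "pverts G \<inter> ?N = {}"
    using fr unfolding fresh_above_def by blast
  then have new: "x \<notin> pverts G" if "x \<in> ?N" for x
    using that by blast
  have ne: "x \<noteq> y" "y \<noteq> x" if "x \<in> pverts G" "y \<in> ?N" for x y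
    using that new by auto
  have no_arc: "(x, y) \<notin> parcs G" "(y, x) \<notin> parcs G" if "y \<in> ?N" for x y
    using that new sub by blast+
  have cc: "(c, c) \<notin> parcs G" using irr by (auto simp: irrefl_def)
  let ?P = "pverts G \<union> ?N"
  have "card ?P = card (pverts G) + card ?N"
    using disj fin by (intro card_Un_disjoint) auto
  then have c1: "card ?P = 16 + 6 * Suc k"
    using card by simp
  have c2: "fresh_above (Suc k) ?P"
    using fr unfolding fresh_above_def by auto
  let ?D = "edges_of {(a, c), (b, c)}"
  let ?E = "edges_of {(a, A1 ?j), (A1 ?j, c), (A1 ?j, A2 ?j), (A2 ?j, B2 ?j), (A2 ?j, C2 ?j),
    (B2 ?j, C2 ?j), (B2 ?j, B1 ?j), (C2 ?j, C1 ?j), (B1 ?j, C1 ?j), (B1 ?j, b), (C1 ?j, c)}"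
  let ?Q = "(parcs G - ?D) \<union> ?E"
  have c3: "?Q \<subseteq> ?P \<times> ?P"
  proof -
    have "?E \<subseteq> ?P \<times> ?P"
      using V unfolding edges_of_simps by (simp del: insert_Times_insert)
    moreover have "parcs G \<subseteq> ?P \<times> ?P"
      using sub by blast
    ultimately show ?thesis by blast
  qed
  have "sym ?E" "sym ?D"
    by (rule sym_edges_of)+
  with sy have c4: "sym ?Q"
    unfolding sym_def by blast
  have "irrefl ?E"
    using ne[OF V(1)] ne[OF V(2)] ne[OF V(3)] unfolding edges_of_simps irrefl_def by simp
  with irr have c5: "irrefl ?Q"
    unfolding irrefl_def by blast
  have c6: "distinct [A2 ?j, B2 ?j, C2 ?j, C1 ?j, B1 ?j, A1 ?j, c]"
    using ne V by auto
  let ?S = "{A2 ?j, B2 ?j, C2 ?j, C1 ?j, B1 ?j, A1 ?j, c}"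
  have "parcs G \<inter> ?S \<times> ?S = {}"
    using no_arc cc by blast
  then have "?Q \<inter> ?S \<times> ?S = ?E \<inter> ?S \<times> ?S"
    by blast
  also have "\<dots> = edges_of {(A2 ?j, B2 ?j), (A2 ?j, C2 ?j), (B2 ?j, C2 ?j), (A2 ?j, A1 ?j),
      (A1 ?j, c), (c, C1 ?j), (C1 ?j, C2 ?j), (B2 ?j, B1 ?j), (C1 ?j, B1 ?j)}"
    using ne[OF V(1)] ne[OF V(2)] ne[OF V(3)] dist unfolding edges_of_simps
    by (simp add: Int_insert_left insert_commute del: insert_Times_insert)
  finally have c7: "?Q \<inter> ?S \<times> ?S = \<dots>" .
  have c8: "?S \<subseteq> ?P" using V by auto
  have c9: "finite ?P" using fin by simp
  have "marked_H (Suc k) = (\<lparr> pverts = ?P, parcs = ?Q \<rparr>,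
      A2 ?j, B2 ?j, C2 ?j, C1 ?j, B1 ?j, A1 ?j, c)"
    by (simp add: M Let_def)
  then show ?thesis
    unfolding marked_ok_def
    by (simp only: prod.case pair_pre_digraph.simps) (intro conjI c1 c2 c3 c4 c5 c6 c7 c8 c9)
qed

lemma marked_ok_marked_H: "marked_ok k (marked_H k)"
proof (induction k)
  case 0
  show ?case by (rule marked_ok_0)
next
  case (Suc k)
  then show ?case by (rule marked_ok_Suc)
qed

lemma H_facts:
  "finite (pverts (H k))" "parcs (H k) \<subseteq> pverts (H k) \<times> pverts (H k)"
  "sym (parcs (H k))" "irrefl (parcs (H k))" "card (pverts (H k)) = 16 + 6 * k"
  using marked_ok_marked_H [of k] unfolding H_def marked_ok_def
  by (simp_all add: split_beta)

lemma pair_graph_H: "pair_graph (H k)"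
proof
  show "finite (parcs (H k))"
    using H_facts(1,2) by (meson finite_SigmaI finite_subset)
  show "symmetric (with_proj (H k))"
    using H_facts(3) by (simp add: symmetric_def)
  show "fst e \<noteq> snd e" if "e \<in> parcs (H k)" for e
    using H_facts(4) [of k] that by (cases e) (auto simp: irrefl_def)
  show "fst e \<in> pverts (H k)" "snd e \<in> pverts (H k)" if "e \<in> parcs (H k)" for e
    using subsetD [OF H_facts(2) that] by (simp_all add: mem_Times_iff)
qed (rule H_facts(1))

end

theory Submission
  imports Defs
begin

text \<open>
  Let \<open>\<phi>\<close> be the distance from the adjacent vertices \<open>x\<^sub>4\<close> and \<open>x\<^sub>5\<close>. Every edge of \<open>H\<^sub>k\<close> other than
  \<open>x\<^sub>4x\<^sub>5\<close> and \<open>ac\<close> changes \<open>\<phi>\<close> by exactly one, while \<open>\<phi>\<close> equals \<open>5 + 2k\<close> at both \<open>a\<close> and \<open>c\<close>. A path of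
  odd length from \<open>x\<^sub>4\<close> to \<open>x\<^sub>5\<close> which is not the edge \<open>x\<^sub>4x\<^sub>5\<close> must therefore, by parity, use the edge
  \<open>ac\<close>, so that its length is at least \<open>2(5 + 2k) + 1\<close>.
\<close>

fun potential :: "vertex \<Rightarrow> nat" where
  "potential (X n) = [2, 1, 3, 2, 0, 0, 1, 1, 2] ! n"
| "potential Va = 5"
| "potential Vb = 4"
| "potential Vc = 5"
| "potential Vd = 4"
| "potential Ve = 3"
| "potential Vf = 4"
| "potential Vg = 3"
| "potential (A1 j) = 4 + 2 * j"
| "potential (A2 j) = 5 + 2 * j"
| "potential (B1 j) = 3 + 2 * j"
| "potential (B2 j) = 4 + 2 * j"
| "potential (C1 j) = 4 + 2 * j"
| "potential (C2 j) = 5 + 2 * j"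

text \<open>Prepending a step that changes \<open>\<phi>\<close> by one keeps the parity of the sum
  and never lowers it. For a step inside level \<open>t\<close>, the first conjunct bounds
  \<open>t\<close> by the remaining length plus \<open>\<phi> v\<close>, which gives
  \<open>2 * t + 1\<close>; it is there to carry the induction.\<close>

lemma odd_walk_length_ge:
  fixes \<phi> :: "'v \<Rightarrow> nat"
  assumes "pcas u p v"
    and "\<And>x y. (x, y) \<in> set p \<Longrightarrow>
      \<phi> x = Suc (\<phi> y) \<or> \<phi> y = Suc (\<phi> x) \<or> \<phi> x = t \<and> \<phi> y = t"
  shows "\<phi> u \<le> length p + \<phi> v \<and>
    (odd (length p + \<phi> u + \<phi> v) \<longrightarrow> 2 * t + 1 \<le> length p + \<phi> u + \<phi> v)"
  using assms
proof (induction p arbitrary: u)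
  case Nil
  then show ?case by simp
next
  case (Cons e p)
  obtain w where e: "e = (u, w)" and w: "pcas w p v"
    using Cons.prems(1) by (cases e) simp
  have "\<phi> u = Suc (\<phi> w) \<or> \<phi> w = Suc (\<phi> u) \<or> \<phi> u = t \<and> \<phi> w = t"
    using Cons.prems(2) e by simp
  moreover have "\<phi> w \<le> length p + \<phi> v \<and>
      (odd (length p + \<phi> w + \<phi> v) \<longrightarrow> 2 * t + 1 \<le> length p + \<phi> w + \<phi> v)"
    using w Cons.prems(2) by (intro Cons.IH) auto
  ultimately show ?case by auto
qed

text \<open>The values at \<open>a\<close>, \<open>b\<close>, \<open>c\<close> are carried along
  because the new vertices are attached exactly there.\<close>

lemma marked_H_potential:
  assumes "marked_H k = (G, a, b, c, d, e, f, g)"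
  shows "potential a = 5 + 2 * k \<and> potential b = 4 + 2 * k \<and> potential c = 5 + 2 * k \<and>
    (X 4, X 5) \<in> parcs G \<and>
    (\<forall>(x, y) \<in> parcs G - edges_of {(a, c), (X 4, X 5)}.
      potential x = Suc (potential y) \<or> potential y = Suc (potential x))"
  using assms
proof (induction k arbitrary: G a b c d e f g)
  case 0
  have "\<forall>(x, y) \<in> parcs H_base. (x, y) \<in> edges_of {(Va, Vc), (X 4, X 5)} \<or>
      potential x = Suc (potential y) \<or> potential y = Suc (potential x)"
    by (simp add: H_base_def edges_of_simps)
  moreover have "(X 4, X 5) \<in> parcs H_base"
    by (simp add: H_base_def edges_of_simps)
  moreover have "G = H_base" "a = Va" "b = Vb" "c = Vc"
    using 0 by simp_all
  ultimately show ?case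
    by (simp add: case_prod_beta) blast
next
  case (Suc k)
  obtain G' a' b' c' d' e' f' g' where M: "marked_H k = (G', a', b', c', d', e', f', g')"
    by (cases "marked_H k") auto
  note IH = Suc.IH [OF M]
  let ?j = "Suc k"
  let ?D = "edges_of {(a', c'), (b', c')}"
  let ?E = "edges_of {(a', A1 ?j), (A1 ?j, c'), (A1 ?j, A2 ?j), (A2 ?j, B2 ?j), (A2 ?j, C2 ?j),
    (B2 ?j, C2 ?j), (B2 ?j, B1 ?j), (C2 ?j, C1 ?j), (B1 ?j, C1 ?j), (B1 ?j, b'), (C1 ?j, c')}"
  have arcs: "parcs G = (parcs G' - ?D) \<union> ?E" and abc: "a = A2 ?j" "b = B2 ?j" "c = C2 ?j"
    using Suc.prems by (auto simp: M Let_def)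
  have "\<forall>(x, y) \<in> ?E. (x, y) \<in> edges_of {(a, c)} \<or>
      potential x = Suc (potential y) \<or> potential y = Suc (potential x)"
    using IH by (simp add: abc edges_of_simps)
  \<comment> \<open>The old level edge \<open>a'c'\<close> is among the deleted ones;
    \<open>ac\<close> takes over its role two levels higher.\<close>
  moreover have "edges_of {(a', c'), (X 4, X 5)} \<subseteq> ?D \<union> edges_of {(X 4, X 5)}"
    and "edges_of {(a, c), (X 4, X 5)} = edges_of {(a, c)} \<union> edges_of {(X 4, X 5)}"
    by (auto simp: edges_of_def)
  ultimately have "\<forall>(x, y) \<in> parcs G - edges_of {(a, c), (X 4, X 5)}.
      potential x = Suc (potential y) \<or> potential y = Suc (potential x)"
    using IH unfolding arcs by blast
  \<comment> \<open>\<open>X 4\<close> has potential 0, whereas the ends of the deleted edges have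
    positive potential.\<close>
  moreover have "(X 4, X 5) \<notin> ?D"
    using IH by (auto simp: edges_of_simps)
  ultimately show ?case
    using IH by (simp add: arcs abc)
qed

theorem lemma3:
  fixes k :: nat
  shows "\<exists>u v. u \<rightarrow>\<^bsub>with_proj (H k)\<^esub> v \<and>
           \<not> (\<exists>p. pre_digraph.apath (with_proj (H k)) u p v \<and>
                  length p \<in> {l. odd l \<and> 3 \<le> l \<and> l \<le> 9 + 4 * k})"
proof -
  interpret pair_graph "H k"
    by (rule pair_graph_H)
  obtain G a b c d e f g where M: "marked_H k = (G, a, b, c, d, e, f, g)"
    by (cases "marked_H k") auto
  then have G: "H k = G"
    by (simp add: H_def)
  note potential = marked_H_potential [OF M, folded G]
  have "11 + 4 * k \<le> length p"
    if path: "apath (X 4) p (X 5)" and "odd (length p)" "3 \<le> length p" for p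
  proof -
    \<comment> \<open>A path never returns to \<open>X 4\<close>, so only its first arc could be the
      edge between \<open>X 4\<close> and \<open>X 5\<close>.\<close>
    obtain w q where p: "p = (X 4, w) # q" and q: "apath w q (X 5)"
      and X4: "X 4 \<notin> set (awalk_verts w q)"
      using path by (cases p) (auto simp: apath_Cons_iff apath_Nil_iff)
    \<comment> \<open>Otherwise \<open>q\<close> would be a path from \<open>X 5\<close> to itself,
      hence empty, and \<open>p\<close> would have length 1.\<close>
    have "w \<noteq> X 5"
      using apath_nonempty_ends [OF q] \<open>3 \<le> length p\<close> p by (cases q) auto
    have step: "potential x = Suc (potential y) \<or> potential y = Suc (potential x) \<or>
        potential x = 5 + 2 * k \<and> potential y = 5 + 2 * k" if "(x, y) \<in> set p" for x y
    proof -
      have "(x, y) \<in> parcs (H k)"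
        using path that by (auto simp: apath_def)
      moreover have "x \<noteq> X 4 \<and> y \<noteq> X 4" if "(x, y) \<in> set q"
        using X4 awalk_verts_arc1 [OF that] awalk_verts_arc2 [OF awalkI_apath [OF q] that] by auto
      with \<open>(x, y) \<in> set p\<close> \<open>w \<noteq> X 5\<close> have "(x, y) \<notin> edges_of {(X 4, X 5)}"
        by (auto simp: p edges_of_simps)
      ultimately show ?thesis
        using potential by (auto simp: edges_of_simps)
    qed
    have "pcas (X 4) p (X 5)"
      using path by (auto simp: apath_def)
    \<comment> \<open>Both ends have potential 0, so the bound with \<open>t = 5 + 2 * k\<close>
      concerns \<open>length p\<close> alone.\<close>
    from odd_walk_length_ge [where \<phi> = potential, OF this step] show ?thesis
      using \<open>odd (length p)\<close> by simp
  qed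
  then have "\<not> (\<exists>p. apath (X 4) p (X 5) \<and> length p \<in> {l. odd l \<and> 3 \<le> l \<and> l \<le> 9 + 4 * k})"
    by fastforce
  moreover have "X 4 \<rightarrow>\<^bsub>with_proj (H k)\<^esub> X 5"
    using potential by simp
  ultimately show ?thesis by blast
qed

end
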